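(* Consider the system of Hammerstein integral equations $$u(t)=\int_{0}^{1}k_{1}(t,s)g_{1}(s)f_{1}(s,u(s),u'(s),v(s),v'(s))\,ds,\qquad v(t)=\int_{0}^{1}k_{2}(t,s)g_{2}(s)f_{2}(s,u(s),u'(s),v(s),v'(s))\,ds,$$ for $t\in[0,1]$, where $k_i,g_i,f_i$ ($i=1,2$) satisfy the assumptions (A1)–(A4) of the context, with $a_i,b_i,c_i$ as in (A3). For $i=1,2$ let $$\frac1{m_i}:=\max_{t\in[0,1]}\int_0^1|k_i(t,s)|g_i(s)\,ds,\qquad \frac1{M_i}:=\min_{t\in[a_i,b_i]}\int_{a_i}^{b_i}k_i(t,s)g_i(s)\,ds.$$ Suppose that the following conditions $(N1)$ and $(N2)$ are satisfied. $(N1)$ Either $$f_1(t,u_1,u_2,v_1,v_2)<m_1|u_1|\quad\text{for every } t\in[0,1],\ u_1\ne0 \text{ and } u_2,v_1,v_2\in\mathbb R,$$ or $$f_1(t,u_1,u_2,v_1,v_2)>\frac{M_1}{c_1}u_1\quad\text{for every } t\in[a_1,b_1],\ u_1>0\text{ and }u_2,v_1,v_2\in\mathbb R,$$ holds. $(N2)$ Either $$f_2(t,u_1,u_2,v_1,v_2)<m_2|v_1|\quad\text{for every } t\in[0,1],\ v_1\ne0 \text{ and } u_1,u_2,v_2\in\mathbb R,$$ or $$f_2(t,u_1,u_2,v_1,v_2)>\frac{M_2}{c_2}v_1\quad\text{for every } t\in[a_2,b_2],\ v_1>0\text{ and }u_1,u_2,v_2\in\mathbb R,$$ holds. Then there is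 no nontrivial solution of the system in the cone $K$ defined in the context.
   Context: Standing assumptions. (A1) For $i=1,2$, $f_i:[0,1]\times\mathbb R^4\to[0,+\infty)$ is $L^\infty$-Carathéodory: $f_i(\cdot,u_1,u_2,v_1,v_2)$ is measurable for each fixed $(u_1,u_2,v_1,v_2)$, $f_i(t,\cdot,\cdot,\cdot,\cdot)$ is continuous for a.e. $t\in[0,1]$, and for each $r>0$ there exists $\varphi_{i,r}\in L^\infty[0,1]$ such that $f_i(t,u_1,u_2,v_1,v_2)\le\varphi_{i,r}(t)$ for $u_1,u_2,v_1,v_2\in[-r,r]$ and a.e. $t\in[0,1]$. (A2) For $i=1,2$, $k_i:[0,1]^2\to\mathbb R$ is measurable, and for all $\tau\in[0,1]$ we have $\lim_{t\to\tau}|k_i(t,s)-k_i(\tau,s)|=0$ for a.e. $s\in[0,1]$ and $\lim_{t\to\tau}\left|\frac{\partial k_i}{\partial t}(t,s)-\frac{\partial k_i}{\partial t}(\tau,s)\right|=0$ for a.e. $s\in[0,1]$. (A3) For $i=1,2$, there exist subintervals $[a_i,b_i],[\gamma_i,\delta_i]\subseteq[0,1]$, functions $\phi_i,\psi_i\in L^\infty[0,1]$ and constants $c_i,d_i\in(0,1]$ such that, for a.e. $s\in[0,1]$: $|k_i(t,s)|\le\phi_i(s)$ for $t\in[0,1]$; $\left|\frac{\partial k_i}{\partial t}(t,s)\right|\le\psi_i(s)$ for $t\in[0,1]$; $k_i(t,s)\ge c_i\phi_i(s)$ for $t\in[a_i,b_i]$; $\frac{\partial k_i}{\partial t}(t,s)\ge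 d_i\psi_i(s)$ for $t\in[\gamma_i,\delta_i]$. (A4) For $i=1,2$, $g_i\in L^1[0,1]$, $g_i(t)\ge0$ for a.e. $t\in[0,1]$, $\int_{a_i}^{b_i}\phi_i(s)g_i(s)\,ds>0$ and $\int_{\gamma_i}^{\delta_i}\psi_i(s)g_i(s)\,ds>0$. Space and cone. $\|w\|_C:=\max_{t\in[0,1]}|w(t)|$, $\|w\|_{C^1}:=\max\{\|w\|_C,\|w'\|_C\}$, and $(C^1[0,1])^2$ has the norm $\|(u,v)\|:=\max\{\|u\|_{C^1},\|v\|_{C^1}\}$. Set $$\tilde K_i:=\Big\{w\in C^1[0,1]:\min_{t\in[a_i,b_i]}w(t)\ge c_i\|w\|_C,\ \min_{t\in[\gamma_i,\delta_i]}w'(t)\ge d_i\|w'\|_C\Big\},\qquad K:=\tilde K_1\times\tilde K_2.$$ A nontrivial solution of the system is a solution $(u,v)\in K$ with $\|(u,v)\|\ne0$. *)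

theory Defs
  imports "HOL-Analysis.Analysis"
begin

definition Linf :: "(real \<Rightarrow> real) \<Rightarrow> bool" where
  "Linf p \<longleftrightarrow> p \<in> borel_measurable (lebesgue_on {0..1}) \<and>
     (\<exists>B. AE t in lebesgue_on {0..1}. \<bar>p t\<bar> \<le> B)"

definition L1 :: "(real \<Rightarrow> real) \<Rightarrow> bool" where
  "L1 g \<longleftrightarrow> integrable (lebesgue_on {0..1}) g"

text \<open>A function on the unit interval is represented by a total function whose values outside
  the interval are irrelevant; derivatives at the end points are one-sided.\<close>

definition D :: "(real \<Rightarrow> real) \<Rightarrow> real \<Rightarrow> real" where
  "D w t = vector_derivative w (at t within {0..1})"

definition C1 :: "(real \<Rightarrow> real) set" where
  "C1 = {w. w differentiable_on {0..1} \<and> continuous_on {0..1} (D w)}"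

text \<open>The maxima and minima of the source are written as suprema and infima. For the norms and
  the cone they are attained because the functions are continuous on compact intervals; for
  the constants \<open>m_const\<close> and \<open>M_const\<close> below they are attained
  because the integrals depend continuously on \<open>t\<close>, by dominated convergence.\<close>

definition norm_C :: "(real \<Rightarrow> real) \<Rightarrow> real" where
  "norm_C w = (SUP t\<in>{0..1}. \<bar>w t\<bar>)"

definition norm_C1 :: "(real \<Rightarrow> real) \<Rightarrow> real" where
  "norm_C1 w = max (norm_C w) (norm_C (D w))"

definition norm_pair :: "(real \<Rightarrow> real) \<times> (real \<Rightarrow> real) \<Rightarrow> real" where
  "norm_pair = (\<lambda>(u, v). max (norm_C1 u) (norm_C1 v))"

definition K_comp ::
  "real \<Rightarrow> real \<Rightarrow> real \<Rightarrow> real \<Rightarrow> real \<Rightarrow> real \<Rightarrow> (real \<Rightarrow> real) set" where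
  "K_comp a b c \<gamma> \<delta> d = {w \<in> C1.
     (INF t\<in>{a..b}. w t) \<ge> c * norm_C w \<and>
     (INF t\<in>{\<gamma>..\<delta>}. D w t) \<ge> d * norm_C (D w)}"

definition Linf_Caratheodory ::
  "(real \<Rightarrow> real \<Rightarrow> real \<Rightarrow> real \<Rightarrow> real \<Rightarrow> real) \<Rightarrow> bool" where
  "Linf_Caratheodory f \<longleftrightarrow>
     (\<forall>u1 u2 v1 v2. (\<lambda>t. f t u1 u2 v1 v2) \<in> borel_measurable (lebesgue_on {0..1})) \<and>
     (AE t in lebesgue_on {0..1}. continuous_on UNIV (\<lambda>(u1, u2, v1, v2). f t u1 u2 v1 v2)) \<and>
     (\<forall>r>0. \<exists>p. Linf p \<and>
        (AE t in lebesgue_on {0..1}.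
           \<forall>u1\<in>{-r..r}. \<forall>u2\<in>{-r..r}. \<forall>v1\<in>{-r..r}. \<forall>v2\<in>{-r..r}. f t u1 u2 v1 v2 \<le> p t))"

definition assm_A1 :: "(real \<Rightarrow> real \<Rightarrow> real \<Rightarrow> real \<Rightarrow> real \<Rightarrow> real) \<Rightarrow> bool" where
  "assm_A1 f \<longleftrightarrow>
     (\<forall>t\<in>{0..1}. \<forall>u1 u2 v1 v2. f t u1 u2 v1 v2 \<ge> 0) \<and> Linf_Caratheodory f"

text \<open>Below, \<open>dk\<close> is the partial derivative of the kernel in its first argument. For each
  \<open>t\<close> it is required to exist only for almost every \<open>s\<close>, so that kernels of
  Green's function type, with a kink on the diagonal, are admitted; the values of \<open>dk\<close>
  at the exceptional points are not prescribed.\<close>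

definition assm_A2 :: "(real \<Rightarrow> real \<Rightarrow> real) \<Rightarrow> (real \<Rightarrow> real \<Rightarrow> real) \<Rightarrow> bool" where
  "assm_A2 k dk \<longleftrightarrow>
     (\<lambda>(t, s). k t s) \<in> borel_measurable (lebesgue_on ({0..1} \<times> {0..1})) \<and>
     (\<forall>t\<in>{0..1}. AE s in lebesgue_on {0..1}.
        ((\<lambda>x. k x s) has_real_derivative dk t s) (at t within {0..1})) \<and>
     (\<forall>\<tau>\<in>{0..1}. AE s in lebesgue_on {0..1}.
        ((\<lambda>t. \<bar>k t s - k \<tau> s\<bar>) \<longlongrightarrow> 0) (at \<tau> within {0..1})) \<and>
     (\<forall>\<tau>\<in>{0..1}. AE s in lebesgue_on {0..1}.
        ((\<lambda>t. \<bar>dk t s - dk \<tau> s\<bar>) \<longlongrightarrow> 0) (at \<tau> within {0..1}))"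

definition assm_A3 ::
  "(real \<Rightarrow> real \<Rightarrow> real) \<Rightarrow> (real \<Rightarrow> real \<Rightarrow> real) \<Rightarrow> (real \<Rightarrow> real) \<Rightarrow> (real \<Rightarrow> real) \<Rightarrow>
   real \<Rightarrow> real \<Rightarrow> real \<Rightarrow> real \<Rightarrow> real \<Rightarrow> real \<Rightarrow> bool" where
  "assm_A3 k dk \<phi> \<psi> a b c \<gamma> \<delta> d \<longleftrightarrow>
     0 \<le> a \<and> a \<le> b \<and> b \<le> 1 \<and> 0 \<le> \<gamma> \<and> \<gamma> \<le> \<delta> \<and> \<delta> \<le> 1 \<and>
     Linf \<phi> \<and> Linf \<psi> \<and> c \<in> {0<..1} \<and> d \<in> {0<..1} \<and>
     (AE s in lebesgue_on {0..1}.
        (\<forall>t\<in>{0..1}. \<bar>k t s\<bar> \<le> \<phi> s) \<and>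
        (\<forall>t\<in>{0..1}. \<bar>dk t s\<bar> \<le> \<psi> s) \<and>
        (\<forall>t\<in>{a..b}. k t s \<ge> c * \<phi> s) \<and>
        (\<forall>t\<in>{\<gamma>..\<delta>}. dk t s \<ge> d * \<psi> s))"

definition assm_A4 ::
  "(real \<Rightarrow> real) \<Rightarrow> (real \<Rightarrow> real) \<Rightarrow> (real \<Rightarrow> real) \<Rightarrow> real \<Rightarrow> real \<Rightarrow> real \<Rightarrow> real \<Rightarrow> bool" where
  "assm_A4 g \<phi> \<psi> a b \<gamma> \<delta> \<longleftrightarrow>
     L1 g \<and> (AE t in lebesgue_on {0..1}. g t \<ge> 0) \<and>
     (LINT s|lebesgue_on {a..b}. \<phi> s * g s) > 0 \<and>
     (LINT s|lebesgue_on {\<gamma>..\<delta>}. \<psi> s * g s) > 0"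

definition m_const :: "(real \<Rightarrow> real \<Rightarrow> real) \<Rightarrow> (real \<Rightarrow> real) \<Rightarrow> real" where
  "m_const k g = 1 / (SUP t\<in>{0..1}. LINT s|lebesgue_on {0..1}. \<bar>k t s\<bar> * g s)"

definition M_const :: "(real \<Rightarrow> real \<Rightarrow> real) \<Rightarrow> (real \<Rightarrow> real) \<Rightarrow> real \<Rightarrow> real \<Rightarrow> real" where
  "M_const k g a b = 1 / (INF t\<in>{a..b}. LINT s|lebesgue_on {a..b}. k t s * g s)"

definition hammerstein_solution ::
  "(real \<Rightarrow> real \<Rightarrow> real) \<Rightarrow> (real \<Rightarrow> real) \<Rightarrow> (real \<Rightarrow> real \<Rightarrow> real \<Rightarrow> real \<Rightarrow> real \<Rightarrow> real) \<Rightarrow>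
   (real \<Rightarrow> real \<Rightarrow> real) \<Rightarrow> (real \<Rightarrow> real) \<Rightarrow> (real \<Rightarrow> real \<Rightarrow> real \<Rightarrow> real \<Rightarrow> real \<Rightarrow> real) \<Rightarrow>
   (real \<Rightarrow> real) \<times> (real \<Rightarrow> real) \<Rightarrow> bool" where
  "hammerstein_solution k1 g1 f1 k2 g2 f2 = (\<lambda>(u, v). \<forall>t\<in>{0..1}.
     u t = (LINT s|lebesgue_on {0..1}. k1 t s * g1 s * f1 s (u s) (D u s) (v s) (D v s)) \<and>
     v t = (LINT s|lebesgue_on {0..1}. k2 t s * g2 s * f2 s (u s) (D u s) (v s) (D v s)))"

end

theory Submission
  imports Defs
begin

text \<open>
  The two equations can be treated separately: along a fixed solution, the components other than
  the one under study only enter the nonlinearity as functions of \<open>s\<close>, and each alternative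
  in the hypotheses is uniform in them. So let \<open>w\<close> lie in one factor of the cone and satisfy
  \<open>w(t) = \<integral> k(t,s) g(s) F(s) ds\<close>, and let \<open>N\<close> be its maximum norm. The claim is
  \<open>N = 0\<close>; then \<open>w\<close> vanishes on the unit interval together with its derivative. Assume
  \<open>N > 0\<close>.

  If the nonlinearity grows less than linearly, evaluate the equation at a point \<open>t\<close> where
  \<open>\<bar>w\<bar>\<close> attains \<open>N\<close>. Almost everywhere \<open>F < m N\<close>, so by the definition of
  \<open>m\<close>, \<open>N \<le> \<integral> \<bar>k(t,s)\<bar> g F ds \<le> m N \<integral> \<bar>k(t,s)\<bar> g ds \<le> N\<close>.
  Equality holds throughout although \<open>F < m N\<close>, which forces \<open>k(t,\<cdot>) g = 0\<close> almost
  everywhere and hence \<open>w(t) = 0\<close>, a contradiction.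

  If it grows more than linearly, evaluate at \<open>t = a\<close>. The cone gives \<open>w \<ge> c N > 0\<close> on
  \<open>[a,b]\<close>, so \<open>F > M N\<close> there, and since \<open>k(a,\<cdot>) g \<ge> 0\<close>,
  \<open>N \<ge> w(a) \<ge> \<integral>\<^sub>a\<^sup>b k(a,s) g F ds \<ge> M N \<integral>\<^sub>a\<^sup>b k(a,s) g ds \<ge> N\<close>. Again
  equality forces \<open>k(a,\<cdot>) g = 0\<close> almost everywhere on \<open>[a,b]\<close>, which contradicts the
  positivity of \<open>\<integral>\<^sub>a\<^sup>b k(a,s) g ds\<close>.

  The two arguments are \<open>sublinear_Hammerstein_zero\<close> and
  \<open>superlinear_Hammerstein_zero\<close>; both conclude by
  \<open>AE_weight_zero_of_integral_nonpos\<close>. Two points of measurability need care. The integrand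
  \<open>k(t,\<cdot>) g F\<close> is integrable at every \<open>t\<close> with \<open>w(t) \<noteq> 0\<close>, because the
  Lebesgue integral of a function that is not integrable is \<open>0\<close> by convention. The kernel is only known to be jointly Lebesgue
  measurable, which says nothing about an individual section; that every section is measurable
  (\<open>kernel_section_measurable\<close>) comes from Fubini's theorem together with the continuity of
  the kernel in its first variable.
\<close>

section \<open>Integrals over subintervals and positive weights\<close>

lemma AE_lebesgue_on_subset:
  fixes S T :: "real set"
  assumes "AE x in lebesgue_on T. P x" "S \<subseteq> T" "S \<in> sets lebesgue" "T \<in> sets lebesgue"
  shows "AE x in lebesgue_on S. P x"
  using assms by (auto simp: AE_restrict_space_iff elim!: eventually_mono)

lemma integrable_lebesgue_on_subset:
  fixes f :: "real \<Rightarrow> real"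
  assumes "integrable (lebesgue_on T) f" "S \<subseteq> T" "S \<in> sets lebesgue" "T \<in> sets lebesgue"
  shows "integrable (lebesgue_on S) f"
  using set_integrable_subset[of lebesgue T f S] assms by (simp add: set_integrable_eq)

text \<open>This turns the equality case of the two chains of inequalities into the vanishing of the
  weight \<open>h\<close>: there \<open>p\<close> is the strictly positive gap between a constant and the
  nonlinearity.\<close>

lemma AE_weight_zero_of_integral_nonpos:
  fixes h p :: "'a \<Rightarrow> real"
  assumes int: "integrable M (\<lambda>s. h s * p s)"
    and h: "AE s in M. 0 \<le> h s" and p: "AE s in M. 0 < p s"
    and le: "(LINT s|M. h s * p s) \<le> 0"
  shows "AE s in M. h s = 0"
proof -
  have nn: "AE s in M. 0 \<le> h s * p s"
    using h p by eventually_elim simp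
  with le have "(LINT s|M. h s * p s) = 0"
    using integral_nonneg_AE[OF nn] by linarith
  then have "AE s in M. h s * p s = 0"
    using integral_nonneg_eq_0_iff_AE[OF int nn] by simp
  then show ?thesis
    using p by eventually_elim auto
qed

section \<open>Measurability and integrability of the kernel sections\<close>

text \<open>A Lebesgue measurable function on the plane agrees almost everywhere with a Borel function,
  whose sections are all Borel. By Fubini's theorem almost every section of the exceptional null set
  is null. Only almost every section is reached in this way, because a null set of the plane can
  contain an arbitrary subset of a line.\<close>

lemma AE_section_lebesgue_measurable:
  fixes k :: "real \<Rightarrow> real \<Rightarrow> real"
  assumes "(\<lambda>(t, s). k t s) \<in> borel_measurable (lebesgue_on (A \<times> B))"
    and A: "A \<in> sets borel" and B: "B \<in> sets borel"
  shows "AE t in lebesgue. t \<in> A \<longrightarrow> k t \<in> borel_measurable (lebesgue_on B)"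
proof -
  define k' where "k' = (\<lambda>p. if p \<in> A \<times> B then (\<lambda>(t, s). k t s) p else 0)"
  have AB: "A \<times> B \<in> sets (borel :: (real \<times> real) measure)"
    using A B by (simp add: borel_prod[symmetric])
  have "k' \<in> borel_measurable lebesgue"
    unfolding k'_def using assms(1) AB by (intro borel_measurable_if_I) auto
  then obtain q where q: "q \<in> borel_measurable lborel" and eq: "AE p in lborel. k' p = q p"
    using completion_ex_borel_measurable_real by blast
  have "AE p in lborel \<Otimes>\<^sub>M lborel. k' p = q p"
    using eq unfolding lborel_prod .
  then have "AE t in lborel. AE s in lborel. k' (t, s) = q (t, s)"
    by (rule lborel_pair.AE_pair)
  then have "AE t in lebesgue. AE s in lborel. k' (t, s) = q (t, s)"
    by (rule AE_completion)
  then show ?thesis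
  proof eventually_elim
    case (elim t)
    have "q \<in> borel_measurable (borel \<Otimes>\<^sub>M borel)"
      using q by (simp add: borel_prod)
    then have "(\<lambda>s. q (t, s)) \<in> borel_measurable borel"
      by measurable
    then have "(\<lambda>s. q (t, s)) \<in> borel_measurable lebesgue"
      by (intro measurable_completion) simp
    moreover have "AE s in lebesgue. q (t, s) = k' (t, s)"
      using AE_completion[OF elim] by eventually_elim simp
    ultimately have m: "(\<lambda>s. k' (t, s)) \<in> borel_measurable lebesgue"
      by (rule borel_measurable_AE)
    show ?case
    proof
      assume "t \<in> A"
      then have "(\<lambda>s. k' (t, s)) = (\<lambda>s. if s \<in> B then k t s else 0)"
        by (auto simp: k'_def)
      with m show "k t \<in> borel_measurable (lebesgue_on B)"
        by (intro borel_measurable_if_D) simp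
    qed
  qed
qed

text \<open>The parameters with a measurable section have full measure, hence are dense in the unit
  interval. Every other section is therefore an almost everywhere limit of measurable ones, by the
  continuity of the kernel in its first variable.\<close>

lemma kernel_section_measurable:
  assumes A2: "assm_A2 k dk" and \<tau>: "\<tau> \<in> {0..1}"
  shows "k \<tau> \<in> borel_measurable (lebesgue_on {0..1})"
proof -
  define G where "G = {t \<in> {0..1}. k t \<in> borel_measurable (lebesgue_on {0..1})}"
  have ae: "AE t in lebesgue. t \<in> {0..1} \<longrightarrow> k t \<in> borel_measurable (lebesgue_on {0..1})"
    using A2 by (intro AE_section_lebesgue_measurable) (auto simp: assm_A2_def)
  \<comment> \<open>Density of \<open>G\<close>: a closed set that contains almost every point of an open interval
    contains the whole interval.\<close>
  have "t \<in> closure G" if "t \<in> {0<..<1}" for t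
  proof (rule mem_closed_if_AE_lebesgue_open[OF _ _ _ that])
    show "AE x\<in>{0<..<1} in lebesgue. x \<in> closure G"
      using ae closure_subset[of G] by (auto simp: G_def elim!: eventually_mono)
  qed auto
  then have "closure {0<..<1} \<subseteq> closure G"
    by (intro closure_minimal) auto
  then have "\<tau> \<in> closure G"
    using \<tau> by auto
  show ?thesis
  proof (cases "\<tau> \<in> G")
    case True
    then show ?thesis by (simp add: G_def)
  next
    case False
    obtain x where x: "\<And>n. x n \<in> G" "x \<longlonglongrightarrow> \<tau>"
      using \<open>\<tau> \<in> closure G\<close> by (auto simp: closure_sequential)
    have lim: "filterlim x (at \<tau> within {0..1}) sequentially"
      using x False by (auto simp: filterlim_at G_def intro!: always_eventually)
    define y where "y n s = (if s \<in> {0..1} then k (x n) s else 0)" for n s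
    have "y n \<in> borel_measurable lebesgue" for n
      unfolding y_def using x(1)[of n] by (intro borel_measurable_if_I) (auto simp: G_def)
    then have "(\<lambda>s. lim (\<lambda>n. y n s)) \<in> borel_measurable lebesgue"
      by (intro borel_measurable_lim_metric)
    moreover have "AE s in lebesgue. lim (\<lambda>n. y n s) = (if s \<in> {0..1} then k \<tau> s else 0)"
    proof -
      have "AE s in lebesgue_on {0..1}. ((\<lambda>t. \<bar>k t s - k \<tau> s\<bar>) \<longlongrightarrow> 0) (at \<tau> within {0..1})"
        using A2 \<tau> by (simp add: assm_A2_def)
      then have "AE s in lebesgue. s \<in> {0..1} \<longrightarrow> ((\<lambda>t. \<bar>k t s - k \<tau> s\<bar>) \<longlongrightarrow> 0) (at \<tau> within {0..1})"
        by (simp add: AE_restrict_space_iff)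
      then show ?thesis
      proof eventually_elim
        case (elim s)
        show ?case
        proof (cases "s \<in> {0..1}")
          case True
          then have "(\<lambda>n. \<bar>k (x n) s - k \<tau> s\<bar>) \<longlonglongrightarrow> 0"
            using elim filterlim_compose[OF _ lim] by blast
          then have "(\<lambda>n. k (x n) s) \<longlonglongrightarrow> k \<tau> s"
            by (simp add: tendsto_rabs_zero_iff LIM_zero_iff)
          with True show ?thesis
            by (simp add: y_def limI)
        qed (auto simp: y_def simp flip: atLeastAtMost_iff)
      qed
    qed
    ultimately have "(\<lambda>s. if s \<in> {0..1} then k \<tau> s else 0) \<in> borel_measurable lebesgue"
      by (rule borel_measurable_AE)
    then show ?thesis
      by (rule borel_measurable_if_D)
  qed
qed

text \<open>Both facts follow from the domination \<open>\<bar>k(t,s)\<bar> g(s) \<le> B g(s)\<close>, with \<open>B\<close> an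
  essential bound of \<open>\<phi>\<close>. The uniform bound makes the supremum in the definition of
  \<open>m_const\<close> a genuine one, so that it bounds each of the integrals.\<close>

lemma kernel_weight_bounds:
  assumes A2: "assm_A2 k dk" and A3: "assm_A3 k dk \<phi> \<psi> a b c \<gamma> \<delta> d"
    and A4: "assm_A4 g \<phi> \<psi> a b \<gamma> \<delta>"
  shows kernel_weight_integrable:
      "t \<in> {0..1} \<Longrightarrow> integrable (lebesgue_on {0..1}) (\<lambda>s. k t s * g s)"
    and kernel_weight_bdd_above:
      "bdd_above ((\<lambda>t. LINT s|lebesgue_on {0..1}. \<bar>k t s\<bar> * g s) ` {0..1})"
proof -
  let ?M = "lebesgue_on {0..1::real}"
  have g: "integrable ?M g" and g0: "AE s in ?M. 0 \<le> g s"
    using A4 by (auto simp: assm_A4_def L1_def)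
  obtain B where B: "AE s in ?M. \<bar>\<phi> s\<bar> \<le> B"
    using A3 by (auto simp: assm_A3_def Linf_def)
  have "AE s in ?M. \<forall>t\<in>{0..1}. \<bar>k t s\<bar> \<le> \<phi> s"
    using A3 unfolding assm_A3_def by (auto elim!: eventually_mono)
  then have bound: "AE s in ?M. \<forall>t\<in>{0..1}. \<bar>k t s\<bar> * g s \<le> B * g s \<and> \<bar>k t s * g s\<bar> \<le> B * g s"
    using B g0
  proof eventually_elim
    case (elim s)
    have "\<bar>k t s\<bar> * g s \<le> B * g s" if "t \<in> {0..1}" for t
      using elim that by (intro mult_right_mono) force+
    then show ?case
      using elim(3) by (auto simp: abs_mult)
  qed
  have int: "integrable ?M (\<lambda>s. k t s * g s)" if t: "t \<in> {0..1}" for t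
  proof (rule Bochner_Integration.integrable_bound)
    show "integrable ?M (\<lambda>s. B * g s)"
      using g by simp
    show "(\<lambda>s. k t s * g s) \<in> borel_measurable ?M"
      using kernel_section_measurable[OF A2 t] g by measurable
    show "AE s in ?M. norm (k t s * g s) \<le> norm (B * g s)"
      using bound by eventually_elim (use t in force)
  qed
  then show "t \<in> {0..1} \<Longrightarrow> integrable ?M (\<lambda>s. k t s * g s)" .
  show "bdd_above ((\<lambda>t. LINT s|?M. \<bar>k t s\<bar> * g s) ` {0..1})"
  proof (rule bdd_aboveI2)
    fix t :: real assume t: "t \<in> {0..1}"
    have "AE s in ?M. \<bar>k t s * g s\<bar> = \<bar>k t s\<bar> * g s"
      using g0 by eventually_elim (simp add: abs_mult)
    then have "integrable ?M (\<lambda>s. \<bar>k t s\<bar> * g s)"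
      using integrable_abs[OF int[OF t]] kernel_section_measurable[OF A2 t] g
      by (subst integrable_cong_AE[symmetric]) auto
    then show "(LINT s|?M. \<bar>k t s\<bar> * g s) \<le> (LINT s|?M. B * g s)"
      using g bound t by (intro integral_mono_AE) (auto elim!: eventually_mono)
  qed
qed

section \<open>The norms\<close>

lemma abs_le_norm_C:
  assumes "continuous_on {0..1} w" "t \<in> {0..1}"
  shows "\<bar>w t\<bar> \<le> norm_C w"
  unfolding norm_C_def
proof (rule cSUP_upper[OF assms(2)])
  show "bdd_above ((\<lambda>t. \<bar>w t\<bar>) ` {0..1})"
    using assms(1)
    by (intro bounded_imp_bdd_above compact_imp_bounded compact_continuous_image continuous_intros)
      auto
qed

lemma norm_C_attained:
  assumes "continuous_on {0..1} w"
  obtains t where "t \<in> {0..1}" "norm_C w = \<bar>w t\<bar>"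
proof -
  have "continuous_on {0..1} (\<lambda>t. \<bar>w t\<bar>)"
    using assms by (intro continuous_intros)
  then obtain t where t: "t \<in> {0..1}" "\<forall>y\<in>{0..1}. \<bar>w y\<bar> \<le> \<bar>w t\<bar>"
    using continuous_attains_sup[of "{0..1}" "\<lambda>t. \<bar>w t\<bar>"] by fastforce
  then have "norm_C w \<le> \<bar>w t\<bar>"
    unfolding norm_C_def by (intro cSUP_least) auto
  with abs_le_norm_C[OF assms t(1)] t(1) show thesis
    by (intro that) auto
qed

lemma norm_C1_zero:
  assumes "\<And>t. t \<in> {0..1} \<Longrightarrow> w t = 0"
  shows "norm_C1 w = 0"
proof -
  have D: "D w t = 0" if "t \<in> {0..1}" for t
  proof -
    have "(w has_vector_derivative 0) (at t within {0..1})"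
      using assms that
      by (intro has_vector_derivative_transform[OF that _ has_vector_derivative_const]) auto
    then show ?thesis
      unfolding D_def using that
      by (intro vector_derivative_within_cbox[of 0 1, simplified]) auto
  qed
  have "norm_C v = 0" if "\<And>t. t \<in> {0..1} \<Longrightarrow> v t = 0" for v
    using that by (simp add: norm_C_def cong: SUP_cong_simp)
  with D assms show ?thesis
    by (simp add: norm_C1_def)
qed

section \<open>Vanishing of a single component\<close>

text \<open>In the sublinear case \<open>F < m N\<close> holds almost everywhere for two different reasons. Where
  \<open>u \<noteq> 0\<close> it is the growth condition, and where \<open>u = 0\<close> it is \<open>F \<le> 0 < m N\<close>. At a
  maximum point of \<open>\<bar>u\<bar>\<close> the equation then gives \<open>N \<le> N\<close> through estimates that are
  strict wherever the weight \<open>\<bar>k(t,s) g(s)\<bar>\<close> is nonzero.\<close>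

lemma sublinear_Hammerstein_zero:
  assumes A2: "assm_A2 k dk" and A3: "assm_A3 k dk \<phi> \<psi> a b c \<gamma> \<delta> d"
    and A4: "assm_A4 g \<phi> \<psi> a b \<gamma> \<delta>"
    and u: "continuous_on {0..1} u"
    and sol: "\<And>t. t \<in> {0..1} \<Longrightarrow> u t = (LINT s|lebesgue_on {0..1}. k t s * g s * F s)"
    and F0: "\<And>s. s \<in> {0..1} \<Longrightarrow> 0 \<le> F s"
    and sub: "\<And>s. s \<in> {0..1} \<Longrightarrow> u s \<noteq> 0 \<Longrightarrow> F s < m_const k g * \<bar>u s\<bar>"
    and zero: "AE s in lebesgue_on {0..1}. u s = 0 \<longrightarrow> F s \<le> 0"
  shows "norm_C u = 0"
proof (rule ccontr)
  let ?M = "lebesgue_on {0..1::real}"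
  define m where "m = m_const k g"
  define N where "N = norm_C u"
  assume "norm_C u \<noteq> 0"
  obtain t where t: "t \<in> {0..1}" and N: "N = \<bar>u t\<bar>"
    using norm_C_attained[OF u] N_def by metis
  with \<open>norm_C u \<noteq> 0\<close> have ut: "u t \<noteq> 0" and "0 < N"
    by (auto simp: N_def)
  have "0 < m * \<bar>u t\<bar>"
    using F0[OF t] sub[OF t ut] by (simp add: m_def)
  with ut have m: "0 < m"
    by (simp add: zero_less_mult_iff)
  have g0: "AE s in ?M. 0 \<le> g s" and g: "g \<in> borel_measurable ?M"
    using A4 by (auto simp: assm_A4_def L1_def)
  \<comment> \<open>Otherwise the integral would be \<open>0\<close> by convention, but it equals \<open>u t\<close>.\<close>
  have int: "integrable ?M (\<lambda>s. k t s * g s * F s)"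
    using sol[OF t] ut not_integrable_integral_eq by metis
  have intk: "integrable ?M (\<lambda>s. \<bar>k t s * g s\<bar>)"
    using kernel_weight_integrable[OF A2 A3 A4 t] by simp
  have S1: "(LINT s|?M. \<bar>k t s * g s\<bar>) \<le> 1 / m"
  proof -
    have "(LINT s|?M. \<bar>k t s * g s\<bar>) = (LINT s|?M. \<bar>k t s\<bar> * g s)"
      using g0 g kernel_section_measurable[OF A2 t]
      by (intro integral_cong_AE) (auto elim!: eventually_mono simp: abs_mult)
    also have "\<dots> \<le> (SUP t\<in>{0..1}. LINT s|?M. \<bar>k t s\<bar> * g s)"
      using t by (intro cSUP_upper kernel_weight_bdd_above[OF A2 A3 A4])
    also have "\<dots> = 1 / m"
      by (simp add: m_def m_const_def)
    finally show ?thesis .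
  qed
  have FN: "AE s in ?M. 0 < m * N - F s"
    using zero AE_space
  proof eventually_elim
    case (elim s)
    then have s: "s \<in> {0..1}" by simp
    show ?case
    proof (cases "u s = 0")
      case True
      then show ?thesis using elim m \<open>0 < N\<close> by (smt (verit) mult_pos_pos)
    next
      case False
      have "m * \<bar>u s\<bar> \<le> m * N"
        using m abs_le_norm_C[OF u s] by (simp add: N_def)
      then show ?thesis using sub[OF s False] by (simp add: m_def)
    qed
  qed
  have intF: "integrable ?M (\<lambda>s. \<bar>k t s * g s\<bar> * F s)"
    using integrable_abs[OF int] F0
    by (subst Bochner_Integration.integrable_cong[OF refl, where g = "\<lambda>s. \<bar>k t s * g s * F s\<bar>"])
      (auto simp: abs_mult)
  have lower: "N \<le> (LINT s|?M. \<bar>k t s * g s\<bar> * F s)"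
  proof -
    have "N \<le> (LINT s|?M. \<bar>k t s * g s * F s\<bar>)"
      unfolding N sol[OF t] by (rule integral_abs_bound)
    also have "\<dots> = (LINT s|?M. \<bar>k t s * g s\<bar> * F s)"
      using F0 by (intro Bochner_Integration.integral_cong) (auto simp: abs_mult)
    finally show ?thesis .
  qed
  have diff: "(\<lambda>s. \<bar>k t s * g s\<bar> * (m * N - F s)) = (\<lambda>s. \<bar>k t s * g s\<bar> * (m * N) - \<bar>k t s * g s\<bar> * F s)"
    by (simp add: algebra_simps)
  have "(LINT s|?M. \<bar>k t s * g s\<bar>) * (m * N) \<le> 1 / m * (m * N)"
    using S1 m \<open>0 < N\<close> by (intro mult_right_mono) auto
  then have upper: "(LINT s|?M. \<bar>k t s * g s\<bar> * (m * N)) \<le> N"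
    using m by simp
  have "AE s in ?M. \<bar>k t s * g s\<bar> = 0"
  proof (rule AE_weight_zero_of_integral_nonpos[OF _ _ FN])
    show "integrable ?M (\<lambda>s. \<bar>k t s * g s\<bar> * (m * N - F s))"
      unfolding diff using intk intF by (intro Bochner_Integration.integrable_diff) auto
    have "(LINT s|?M. \<bar>k t s * g s\<bar> * (m * N - F s))
        = (LINT s|?M. \<bar>k t s * g s\<bar> * (m * N)) - (LINT s|?M. \<bar>k t s * g s\<bar> * F s)"
      unfolding diff using intk intF by (intro Bochner_Integration.integral_diff) auto
    with upper lower show "(LINT s|?M. \<bar>k t s * g s\<bar> * (m * N - F s)) \<le> 0"
      by linarith
  qed auto
  then have "AE s in ?M. k t s * g s * F s = 0"
    by eventually_elim auto
  then have "u t = 0"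
    using sol[OF t] by (simp add: integral_eq_zero_AE)
  with ut show False by simp
qed

text \<open>In the superlinear case membership in the cone provides the lower bound \<open>u \<ge> c N\<close> on
  \<open>[a,b]\<close>, where the factor \<open>c\<close> cancels the one in the growth condition, so that
  \<open>F > M N\<close>. The comparison is made at \<open>a\<close>, as an arbitrary point of \<open>[a,b]\<close>. The constant \<open>M\<close> is finite and positive because the integrals \<open>J t\<close> of the weight
  are bounded below by \<open>c \<integral>\<^sub>a\<^sup>b \<phi> g ds > 0\<close>.\<close>

lemma superlinear_Hammerstein_zero:
  assumes A2: "assm_A2 k dk" and A3: "assm_A3 k dk \<phi> \<psi> a b c \<gamma> \<delta> d"
    and A4: "assm_A4 g \<phi> \<psi> a b \<gamma> \<delta>"
    and u: "continuous_on {0..1} u"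
    and cone: "c * norm_C u \<le> (INF t\<in>{a..b}. u t)"
    and sol: "\<And>t. t \<in> {0..1} \<Longrightarrow> u t = (LINT s|lebesgue_on {0..1}. k t s * g s * F s)"
    and F0: "\<And>s. s \<in> {0..1} \<Longrightarrow> 0 \<le> F s"
    and super: "\<And>s. s \<in> {a..b} \<Longrightarrow> 0 < u s \<Longrightarrow> M_const k g a b / c * u s < F s"
  shows "norm_C u = 0"
proof (rule ccontr)
  let ?M = "lebesgue_on {0..1::real}" and ?L = "lebesgue_on {a..b}"
  define N where "N = norm_C u"
  define J where "J t = (LINT s|?L. k t s * g s)" for t
  assume "norm_C u \<noteq> 0"
  moreover have "0 \<le> norm_C u"
    using abs_le_norm_C[OF u, of 0] by simp
  ultimately have N: "0 < N"
    by (simp add: N_def)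
  have ab: "0 \<le> a" "a \<le> b" "b \<le> 1" and c: "0 < c"
    using A3 by (auto simp: assm_A3_def)
  have sub: "{a..b} \<subseteq> {0..1}"
    using ab by auto
  have g0: "AE s in ?M. 0 \<le> g s"
    using A4 by (simp add: assm_A4_def)
  have phig: "0 < (LINT s|?L. \<phi> s * g s)"
    using A4 by (simp add: assm_A4_def)
  have kpos: "AE s in ?M. \<forall>t\<in>{a..b}. c * (\<phi> s * g s) \<le> k t s * g s \<and> 0 \<le> k t s * g s"
  proof -
    have "AE s in ?M. (\<forall>t\<in>{0..1}. \<bar>k t s\<bar> \<le> \<phi> s) \<and> (\<forall>t\<in>{a..b}. c * \<phi> s \<le> k t s)"
      using A3 unfolding assm_A3_def by (auto elim!: eventually_mono)
    then show ?thesis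
      using g0
    proof eventually_elim
      case (elim s)
      \<comment> \<open>The domination at one parameter, here \<open>0\<close>, shows \<open>\<phi> s \<ge> 0\<close>.\<close>
      have "\<bar>k 0 s\<bar> \<le> \<phi> s"
        using elim(1) by simp
      then have "0 \<le> c * \<phi> s"
        using c by (intro mult_nonneg_nonneg) auto
      then show ?case
        using elim
        by (auto simp: mult.assoc[symmetric] intro!: mult_right_mono mult_nonneg_nonneg)
    qed
  qed
  have intk: "integrable ?L (\<lambda>s. k t s * g s)" if "t \<in> {a..b}" for t
    using integrable_lebesgue_on_subset[OF kernel_weight_integrable[OF A2 A3 A4] sub] that sub by auto
  have J: "c * (LINT s|?L. \<phi> s * g s) \<le> J t" if t: "t \<in> {a..b}" for t
  proof -
    have "integrable ?L (\<lambda>s. \<phi> s * g s)"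
      using phig not_integrable_integral_eq by fastforce
    moreover have "AE s in ?L. c * (\<phi> s * g s) \<le> k t s * g s"
      using AE_lebesgue_on_subset[OF kpos sub] t by (auto elim!: eventually_mono)
    ultimately have "(LINT s|?L. c * (\<phi> s * g s)) \<le> J t"
      unfolding J_def by (intro integral_mono_AE intk[OF t]) auto
    then show ?thesis by simp
  qed
  define I where "I = (INF t\<in>{a..b}. J t)"
  have IJ: "I \<le> J a"
    unfolding I_def using J ab by (intro cINF_lower bdd_belowI2) auto
  have "c * (LINT s|?L. \<phi> s * g s) \<le> I"
    unfolding I_def using J ab by (intro cINF_greatest) auto
  with c phig have I: "0 < I"
    by (smt (verit) mult_pos_pos)
  have M: "M_const k g a b = 1 / I"
    by (simp add: M_const_def I_def J_def)
  have ucone: "c * N \<le> u s" if s: "s \<in> {a..b}" for s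
  proof -
    have "bdd_below (u ` {a..b})"
      using continuous_on_subset[OF u sub]
      by (intro bounded_imp_bdd_below compact_imp_bounded compact_continuous_image) auto
    then have "(INF t\<in>{a..b}. u t) \<le> u s"
      using s by (rule cINF_lower)
    with cone show ?thesis by (simp add: N_def)
  qed
  have FN: "0 < F s - N / I" if s: "s \<in> {a..b}" for s
  proof -
    have "0 < c * N" using c N by simp
    then have "M_const k g a b / c * u s < F s"
      using ucone[OF s] by (intro super[OF s]) linarith
    moreover have "M_const k g a b / c * (c * N) \<le> M_const k g a b / c * u s"
      using c I ucone[OF s] by (intro mult_left_mono) (auto simp: M)
    ultimately show ?thesis
      using c by (simp add: M)
  qed
  have a: "a \<in> {0..1}" "a \<in> {a..b}"
    using ab by auto
  have "0 < c * N" using c N by simp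
  then have "u a \<noteq> 0"
    using ucone[OF a(2)] by linarith
  \<comment> \<open>Otherwise the integral would be \<open>0\<close> by convention, but it equals \<open>u a\<close>.\<close>
  then have int: "integrable ?M (\<lambda>s. k a s * g s * F s)"
    using sol[OF a(1)] not_integrable_integral_eq by metis
  then have intL: "integrable ?L (\<lambda>s. k a s * g s * F s)"
    using sub by (rule integrable_lebesgue_on_subset) auto
  have upper: "(LINT s|?L. k a s * g s * F s) \<le> N"
  proof -
    have "AE s in ?M. 0 \<le> k a s * g s * F s"
      using kpos AE_space by eventually_elim (use a F0 in auto)
    then have "(LINT s|?L. k a s * g s * F s) \<le> (LINT s|?M. k a s * g s * F s)"
      using int sub by (intro integral_mono_lebesgue_on_AE) auto
    also have "\<dots> \<le> N"
      using sol[OF a(1)] abs_le_norm_C[OF u a(1)] by (simp add: N_def)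
    finally show ?thesis .
  qed
  have "N \<le> J a * (N / I)"
    using IJ I N by (simp add: field_simps)
  then have lower: "N \<le> (LINT s|?L. k a s * g s * (N / I))"
    by (simp add: J_def)
  have diff: "(\<lambda>s. k a s * g s * (F s - N / I)) = (\<lambda>s. k a s * g s * F s - k a s * g s * (N / I))"
    by (simp add: algebra_simps)
  have intc: "integrable ?L (\<lambda>s. k a s * g s * (N / I))"
    by (intro integrable_mult_left intk[OF a(2)])
  have "AE s in ?L. k a s * g s = 0"
  proof (rule AE_weight_zero_of_integral_nonpos)
    show "integrable ?L (\<lambda>s. k a s * g s * (F s - N / I))"
      unfolding diff using intL intc by (rule Bochner_Integration.integrable_diff)
    show "AE s in ?L. 0 \<le> k a s * g s"
      using AE_lebesgue_on_subset[OF kpos sub] a by (auto elim!: eventually_mono)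
    show "AE s in ?L. 0 < F s - N / I"
      using FN by (intro AE_I2) auto
    show "(LINT s|?L. k a s * g s * (F s - N / I)) \<le> 0"
      unfolding diff Bochner_Integration.integral_diff[OF intL intc] using upper lower by linarith
  qed
  then have "J a = 0"
    unfolding J_def by (rule integral_eq_zero_AE)
  with IJ I show False by simp
qed

text \<open>The growth condition is silent at \<open>0\<close>; continuity of the nonlinearity extends its weak
  form to that point, which covers the zeros of the solution.\<close>

lemma continuous_sublinear_at_zero:
  fixes h :: "real \<Rightarrow> real"
  assumes "continuous_on UNIV h" and "\<And>x. x \<noteq> 0 \<Longrightarrow> h x < m * \<bar>x\<bar>"
  shows "h 0 \<le> 0"
proof (rule tendsto_le[of "at 0"])
  show "(h \<longlongrightarrow> h 0) (at 0)"
    using assms(1) by (simp add: continuous_on_def)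
  show "((\<lambda>x. m * \<bar>x\<bar>) \<longlongrightarrow> 0) (at (0::real))"
    by (auto intro!: tendsto_eq_intros)
  show "\<forall>\<^sub>F x in at 0. h x \<le> m * \<bar>x\<bar>"
    using assms(2) by (auto simp: eventually_at_filter less_imp_le intro!: always_eventually)
qed auto

text \<open>Here \<open>h s x\<close> is the nonlinearity as a function of the component under study, with
  all its other arguments already evaluated along the solution.\<close>

lemma Hammerstein_component_zero:
  assumes A2: "assm_A2 k dk" and A3: "assm_A3 k dk \<phi> \<psi> a b c \<gamma> \<delta> d"
    and A4: "assm_A4 g \<phi> \<psi> a b \<gamma> \<delta>"
    and w: "w \<in> K_comp a b c \<gamma> \<delta> d"
    and sol: "\<And>t. t \<in> {0..1} \<Longrightarrow> w t = (LINT s|lebesgue_on {0..1}. k t s * g s * h s (w s))"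
    and h0: "\<And>s x. s \<in> {0..1} \<Longrightarrow> 0 \<le> h s x"
    and cont: "AE s in lebesgue_on {0..1}. continuous_on UNIV (h s)"
    and N: "(\<forall>s\<in>{0..1}. \<forall>x. x \<noteq> 0 \<longrightarrow> h s x < m_const k g * \<bar>x\<bar>) \<or>
            (\<forall>s\<in>{a..b}. \<forall>x>0. M_const k g a b / c * x < h s x)"
  shows "norm_C1 w = 0"
proof -
  have cw: "continuous_on {0..1} w"
    using w by (auto simp: K_comp_def C1_def intro: differentiable_imp_continuous_on)
  have "norm_C w = 0"
    using N
  proof
    assume sub: "\<forall>s\<in>{0..1}. \<forall>x. x \<noteq> 0 \<longrightarrow> h s x < m_const k g * \<bar>x\<bar>"
    have zero: "AE s in lebesgue_on {0..1}. w s = 0 \<longrightarrow> h s (w s) \<le> 0"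
      using cont AE_space
    proof eventually_elim
      case (elim s)
      then show ?case
        using continuous_sublinear_at_zero[of "h s" "m_const k g"] sub by auto
    qed
    show ?thesis
      by (rule sublinear_Hammerstein_zero[OF A2 A3 A4 cw sol _ _ zero]) (use h0 sub in auto)
  next
    assume super: "\<forall>s\<in>{a..b}. \<forall>x>0. M_const k g a b / c * x < h s x"
    have cone: "c * norm_C w \<le> (INF t\<in>{a..b}. w t)"
      using w by (simp add: K_comp_def)
    show ?thesis
      by (rule superlinear_Hammerstein_zero[OF A2 A3 A4 cw cone sol]) (use h0 super in auto)
  qed
  then have "w t = 0" if "t \<in> {0..1}" for t
    using abs_le_norm_C[OF cw that] by simp
  then show ?thesis
    by (rule norm_C1_zero)
qed

section \<open>Nonexistence of nontrivial solutions\<close>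

theorem theorem3p6:
  fixes f1 f2 :: "real \<Rightarrow> real \<Rightarrow> real \<Rightarrow> real \<Rightarrow> real \<Rightarrow> real"
    and k1 k2 dk1 dk2 :: "real \<Rightarrow> real \<Rightarrow> real"
    and g1 g2 \<phi>1 \<phi>2 \<psi>1 \<psi>2 :: "real \<Rightarrow> real"
    and a1 b1 c1 \<gamma>1 \<delta>1 d1 a2 b2 c2 \<gamma>2 \<delta>2 d2 :: real
  assumes "assm_A1 f1" "assm_A1 f2"
    and "assm_A2 k1 dk1" "assm_A2 k2 dk2"
    and "assm_A3 k1 dk1 \<phi>1 \<psi>1 a1 b1 c1 \<gamma>1 \<delta>1 d1"
    and "assm_A3 k2 dk2 \<phi>2 \<psi>2 a2 b2 c2 \<gamma>2 \<delta>2 d2"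
    and "assm_A4 g1 \<phi>1 \<psi>1 a1 b1 \<gamma>1 \<delta>1"
    and "assm_A4 g2 \<phi>2 \<psi>2 a2 b2 \<gamma>2 \<delta>2"
    and N1: "(\<forall>t\<in>{0..1}. \<forall>u1 u2 v1 v2. u1 \<noteq> 0 \<longrightarrow>
                f1 t u1 u2 v1 v2 < m_const k1 g1 * \<bar>u1\<bar>) \<or>
             (\<forall>t\<in>{a1..b1}. \<forall>u1 u2 v1 v2. u1 > 0 \<longrightarrow>
                f1 t u1 u2 v1 v2 > M_const k1 g1 a1 b1 / c1 * u1)"
    and N2: "(\<forall>t\<in>{0..1}. \<forall>u1 u2 v1 v2. v1 \<noteq> 0 \<longrightarrow>
                f2 t u1 u2 v1 v2 < m_const k2 g2 * \<bar>v1\<bar>) \<or>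
             (\<forall>t\<in>{a2..b2}. \<forall>u1 u2 v1 v2. v1 > 0 \<longrightarrow>
                f2 t u1 u2 v1 v2 > M_const k2 g2 a2 b2 / c2 * v1)"
  shows "\<not> (\<exists>w \<in> K_comp a1 b1 c1 \<gamma>1 \<delta>1 d1 \<times> K_comp a2 b2 c2 \<gamma>2 \<delta>2 d2.
            hammerstein_solution k1 g1 f1 k2 g2 f2 w \<and> norm_pair w \<noteq> 0)"
proof (rule notI, elim bexE conjE)
  fix w
  assume w: "w \<in> K_comp a1 b1 c1 \<gamma>1 \<delta>1 d1 \<times> K_comp a2 b2 c2 \<gamma>2 \<delta>2 d2"
    and ham: "hammerstein_solution k1 g1 f1 k2 g2 f2 w" and nz: "norm_pair w \<noteq> 0"
  obtain u v where uv: "w = (u, v)"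
    by fastforce
  have cont1: "AE s in lebesgue_on {0..1}. continuous_on UNIV (\<lambda>(u1, u2, v1, v2). f1 s u1 u2 v1 v2)"
    and cont2: "AE s in lebesgue_on {0..1}. continuous_on UNIV (\<lambda>(u1, u2, v1, v2). f2 s u1 u2 v1 v2)"
    using assms(1,2) by (auto simp: assm_A1_def Linf_Caratheodory_def)
  have "norm_C1 u = 0"
  proof (rule Hammerstein_component_zero[OF assms(3,5,7), where h = "\<lambda>s x. f1 s x (D u s) (v s) (D v s)"])
    show "AE s in lebesgue_on {0..1}. continuous_on UNIV (\<lambda>x. f1 s x (D u s) (v s) (D v s))"
      using cont1
    proof eventually_elim
      case (elim s)
      have "continuous_on UNIV (\<lambda>x. (x, D u s, v s, D v s))"
        by (intro continuous_intros)
      then show ?case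
        using continuous_on_compose2[OF elim] by fastforce
    qed
  qed (use w ham uv assms(1) N1 in \<open>auto simp: hammerstein_solution_def assm_A1_def\<close>)
  moreover have "norm_C1 v = 0"
  proof (rule Hammerstein_component_zero[OF assms(4,6,8), where h = "\<lambda>s x. f2 s (u s) (D u s) x (D v s)"])
    show "AE s in lebesgue_on {0..1}. continuous_on UNIV (\<lambda>x. f2 s (u s) (D u s) x (D v s))"
      using cont2
    proof eventually_elim
      case (elim s)
      have "continuous_on UNIV (\<lambda>x. (u s, D u s, x, D v s))"
        by (intro continuous_intros)
      then show ?case
        using continuous_on_compose2[OF elim] by fastforce
    qed
  qed (use w ham uv assms(2) N2 in \<open>auto simp: hammerstein_solution_def assm_A1_def\<close>)
  ultimately show False
    using nz uv by (simp add: norm_pair_def)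
qed

end
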